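(* Let $\gamma$ be a smooth convex closed curve in the Euclidean plane with the origin $O$ inside it, let $\Gamma$ be its dual curve, let $\mathcal{B}$ be the Birkhoff billiard map of $\gamma$ and $\mathcal{A}$ the Angular billiard map of $\Gamma$. (1) Let $l_0$ be an oriented line intersecting $\gamma$ and let $\mathcal{B}(l_0)=l_1$, $\mathcal{B}^{-1}(l_0)=l_{-1}$, and denote by $L_0,L_1,L_{-1}$ the points dual to $l_0,l_1,l_{-1}$. Then (whenever the lines involved do not pass through $O$, so that the dual points and $\mathcal{A}(L_0)$ are defined) $$\mathcal{A}(L_0)=L_1\ \text{ if } l_0 \text{ is positive},\qquad \mathcal{A}(L_0)=L_{-1}\ \text{ if } l_0\text{ is negative}.$$ (2) Let $A$ be a point outside $\Gamma$ at which $\mathcal{A}$ is defined and let $B=\mathcal{A}(A)$. Let $a,b$ be the positively oriented lines dual to $A,B$, and let $l$ be the positive tangent line to $\Gamma$ passing through $A$, with tangency point $T$. Then $$\mathcal{B}(a)=b\ \text{ if } T\in[A;B],\qquad \mathcal{B}(a)=-b\ \text{ if } T\notin[A;B],$$ where $-b$ denotes $b$ with the reversed orientation.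
   Context: Birkhoff billiard map $\mathcal{B}$: it acts on oriented lines intersecting $\gamma$ (meeting the interior), sending an oriented line to the oriented line obtained by reflecting it, by the law of geometric optics, at the point where it exits the domain bounded by $\gamma$. Sign of a line: an oriented line not through $O$ is positive (negative) if $\sigma(v)=xv_y-yv_x>0$ ($<0$) for a positively oriented vector $v=(v_x,v_y)$ tangent to the line at $(x,y)$. Duality: the line $\{\langle n,X\rangle=p\}$ with $|n|=1$, $p>0$, corresponds to the point $n/p$. $\Gamma$ is the set of points dual to the tangent lines of $\gamma$; $O$ lies inside $\Gamma$. Angular billiard map of $\Gamma$: let $D$ be the convex domain bounded by $\Gamma$ (oriented counterclockwise), $O\in D$, $U=\mathbb{R}^2\setminus D$. For $A\in U$ take, of the two tangent lines from $A$ to $\Gamma$, the right one as seen from $A$ looking at $\Gamma$ (the one for which the direction from $A$ to the tangency point agrees with the orientation of $\Gamma$); this is the positive tangent line through $A$; let $T$ be its tangency point. Let $l_A$ be the line through $O$ symmetric to the line $OA$ with respect to the line $OT$ (so the angle between $OA$ and $OT$ equals the angle between $OT$ and $l_A$; $l_A=OA$ if $OA\perp OT$). Let $\mathcal{S}=\{A\in U: l_A\parallel AT\}$. For $A\in U\setminus\mathcal{S}$, $\mathcal{A}(A)$ is the intersection point of $l_A$ with the tangent line $AT$; in particular $\mathcal{A}(A)=A$ if $OA\perp OT$. *)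

theory Defs
  imports "HOL-Analysis.Analysis"
begin

text \<open>The Euclidean plane is the type \<^typ>\<open>complex\<close> with its real inner product.\<close>

definition cross :: "complex \<Rightarrow> complex \<Rightarrow> real" where
  "cross z w = Re z * Im w - Im z * Re w"

definition line :: "complex \<Rightarrow> complex \<Rightarrow> complex set" where
  "line p v = range (\<lambda>s::real. p + s *\<^sub>R v)"

text \<open>Orthogonal reflection in the line through \<open>0\<close> spanned by \<open>v\<close>.\<close>

definition reflect :: "complex \<Rightarrow> complex \<Rightarrow> complex" where
  "reflect v x = (2 * (v \<bullet> x) / (v \<bullet> v)) *\<^sub>R v - x"

subsection \<open>Smooth convex closed curves\<close>

definition smooth :: "(real \<Rightarrow> complex) \<Rightarrow> bool" where
  "smooth g \<longleftrightarrow>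
     (\<exists>D. D 0 = g \<and> (\<forall>n t. (D n has_vector_derivative D (Suc n) t) (at t)))"

text \<open>
  A closed curve is a \<open>1\<close>-periodic regular parametrisation; \<^term>\<open>path_image g\<close>
  is then all of its image, and \<^term>\<open>inside (path_image g)\<close> is the domain it bounds.
  Neither the direction of the parametrisation nor positive curvature is
  prescribed; straight pieces are allowed.
\<close>

definition smooth_convex_closed_curve :: "(real \<Rightarrow> complex) \<Rightarrow> bool" where
  "smooth_convex_closed_curve g \<longleftrightarrow>
     smooth g \<and> (\<forall>t. vector_derivative g (at t) \<noteq> 0) \<and>
     (\<forall>t. g (t + 1) = g t) \<and> simple_path g \<and>
     convex (inside (path_image g))"

definition tangent_line :: "(real \<Rightarrow> complex) \<Rightarrow> real \<Rightarrow> complex set" where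
  "tangent_line g t = line (g t) (vector_derivative g (at t))"

subsection \<open>Oriented lines\<close>

text \<open>An oriented line is the set of its points together with its unit direction vector.\<close>

type_synonym oriented_line = "complex set \<times> complex"

definition is_oriented_line :: "oriented_line \<Rightarrow> bool" where
  "is_oriented_line = (\<lambda>(l, u). norm u = 1 \<and> (\<exists>p. l = line p u))"

definition reverse :: "oriented_line \<Rightarrow> oriented_line" where
  "reverse = (\<lambda>(l, u). (l, - u))"

text \<open>\<^term>\<open>cross z u\<close> takes the same value at all points \<open>z\<close> of an oriented line \<open>(l, u)\<close>.\<close>

definition positive_line :: "oriented_line \<Rightarrow> bool" where
  "positive_line = (\<lambda>(l, u). \<forall>z\<in>l. cross z u > 0)"

definition negative_line :: "oriented_line \<Rightarrow> bool" where
  "negative_line = (\<lambda>(l, u). \<forall>z\<in>l. cross z u < 0)"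

subsection \<open>The Birkhoff billiard map\<close>

definition billiard_lines :: "(real \<Rightarrow> complex) \<Rightarrow> oriented_line set" where
  "billiard_lines g = {l. is_oriented_line l \<and> fst l \<inter> inside (path_image g) \<noteq> {}}"

definition exits_at :: "(real \<Rightarrow> complex) \<Rightarrow> oriented_line \<Rightarrow> complex \<Rightarrow> bool" where
  "exits_at g = (\<lambda>(l, u) q. q \<in> l \<inter> path_image g \<and>
     (\<exists>e>0. \<forall>s. 0 < s \<and> s < e \<longrightarrow> q - s *\<^sub>R u \<in> inside (path_image g)))"

definition exit_param :: "(real \<Rightarrow> complex) \<Rightarrow> oriented_line \<Rightarrow> real" where
  "exit_param g l = (THE t. 0 \<le> t \<and> t < 1 \<and> exits_at g l (g t))"

text \<open>Meaningful on \<^term>\<open>billiard_lines g\<close>, which it maps to itself.\<close>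

definition birkhoff :: "(real \<Rightarrow> complex) \<Rightarrow> oriented_line \<Rightarrow> oriented_line" where
  "birkhoff g = (\<lambda>(l, u).
     let t = exit_param g (l, u); w = reflect (vector_derivative g (at t)) u
     in (line (g t) w, w))"

subsection \<open>Duality\<close>

definition dual :: "complex set \<Rightarrow> complex \<Rightarrow> bool" where
  "dual l L \<longleftrightarrow>
     (\<exists>n p. norm n = 1 \<and> p > 0 \<and> l = {X. n \<bullet> X = p} \<and> L = n /\<^sub>R p)"

definition dual_curve :: "(real \<Rightarrow> complex) \<Rightarrow> complex set" where
  "dual_curve g = {L. \<exists>t. dual (tangent_line g t) L}"

subsection \<open>The angular billiard map\<close>

text \<open>
  \<open>l\<close> is the positive tangent line from \<open>A\<close> to the closed convex curve \<open>\<Gamma>\<close>, and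
  \<open>T\<close> its tangency point: the curve lies to the left of the ray from \<open>A\<close> to \<open>T\<close>, so
  \<open>l\<close> is the right one of the two tangent lines seen from \<open>A\<close>, and the direction from
  \<open>A\<close> to \<open>T\<close> is that of \<open>\<Gamma>\<close> traversed counterclockwise. Tangent lines of a convex
  curve are its supporting lines; the dual of a smooth convex curve has a corner for
  every straight piece of the latter.
\<close>

definition positive_tangent :: "complex set \<Rightarrow> complex \<Rightarrow> complex set \<Rightarrow> complex \<Rightarrow> bool" where
  "positive_tangent \<Gamma> A l T \<longleftrightarrow>
     T \<in> \<Gamma> \<and> l = affine hull {A, T} \<and> (\<forall>X\<in>\<Gamma>. cross (T - A) (X - A) \<ge> 0)"

definition tangency_point :: "complex set \<Rightarrow> complex \<Rightarrow> complex" where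
  "tangency_point \<Gamma> A = (THE T. \<exists>l. positive_tangent \<Gamma> A l T)"

definition symmetric_line :: "complex set \<Rightarrow> complex \<Rightarrow> complex set" where
  "symmetric_line \<Gamma> A = reflect (tangency_point \<Gamma> A) ` (affine hull {0, A})"

definition angular_singular :: "complex set \<Rightarrow> complex set" where
  "angular_singular \<Gamma> = {A \<in> outside \<Gamma>.
     affine_parallel (symmetric_line \<Gamma> A) (affine hull {A, tangency_point \<Gamma> A})}"

definition angular_domain :: "complex set \<Rightarrow> complex set" where
  "angular_domain \<Gamma> = outside \<Gamma> - angular_singular \<Gamma>"

text \<open>Meaningful on \<^term>\<open>angular_domain \<Gamma>\<close>.\<close>

definition angular :: "complex set \<Rightarrow> complex \<Rightarrow> complex" where
  "angular \<Gamma> A =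
     (THE B. B \<in> symmetric_line \<Gamma> A \<inter> affine hull {A, tangency_point \<Gamma> A})"

end

theory Submission
  imports Defs
begin

text \<open>
  The two maps are the same reflection, seen once through directions and once through normals.
  Let a positive oriented line leave the table at \<open>q\<close> with direction \<open>u\<close>, and let \<open>A\<close> be its dual
  point, so that \<open>u\<close> is a positive multiple of \<open>\<i> * A\<close>. The tangent line of the table at \<open>q\<close>
  has a dual point \<open>T\<close>, and its direction is perpendicular to \<open>T\<close>. Reflecting \<open>\<i> * A\<close> in the
  tangent direction gives \<open>\<i> * A'\<close>, where \<open>A'\<close> is \<open>A\<close> reflected in the line \<open>OT\<close>
  (\<open>reflect_perp_rotate\<close>). The outgoing line therefore passes through \<open>q\<close> with normal \<open>A'\<close>:
  its dual point lies on the line \<open>OA'\<close>, and it lies on the line \<open>q \<bullet> X = 1\<close> dual to \<open>q\<close>. The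
  latter is the line \<open>AT\<close>. These are the two lines which the angular billiard map intersects;
  they are parallel exactly when \<open>q \<bullet> A' = 0\<close>, that is, when the outgoing line passes through the
  origin (\<open>angular_of_tangency_point\<close>).

  It remains to see that \<open>T\<close> is the tangency point of the positive tangent line from \<open>A\<close>. The line
  \<open>AT\<close> supports the dual curve because \<open>q\<close> belongs to the closed table, and the curve lies to its
  left because the incoming line is positive and exits at \<open>q\<close>. Smoothness makes \<open>T\<close> unique:
  a corner of the table would give a segment of tangency points
  (\<open>positive_tangent_at_exit\<close>).

  A negative line becomes positive under reversal, and reversing time inverts the billiard map
  (\<open>inv_birkhoff\<close>), which gives the negative case. Conversely, a point is outside the dual
  curve exactly when its dual line meets the table (\<open>outside_dual_curve_iff\<close>), so every point of
  the angular domain comes from a billiard line. The orientation of the outgoing line is the sign of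
  \<open>q \<bullet> A'\<close>. The points \<open>A\<close> and \<open>A'\<close> lie on opposite sides of \<open>OT\<close>, so the same sign decides whether
  the segment from \<open>A\<close> to the image point crosses \<open>OT\<close>, which it can only do at \<open>T\<close>
  (\<open>tangency_point_in_segment_iff\<close>).
\<close>

section \<open>Plane geometry\<close>

lemma rotate_expansion:
  "(L \<bullet> L) *\<^sub>R u = (L \<bullet> u) *\<^sub>R L + ((\<i> * L) \<bullet> u) *\<^sub>R (\<i> * L)" for L u :: complex
  by (simp add: complex_eq_iff inner_complex_def algebra_simps)

lemma perp_imp_rotate:
  fixes L u :: complex
  assumes "L \<noteq> 0" "L \<bullet> u = 0"
  obtains c where "u = c *\<^sub>R (\<i> * L)"
proof
  have "(L \<bullet> L) *\<^sub>R u = ((\<i> * L) \<bullet> u) *\<^sub>R (\<i> * L)"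
    using rotate_expansion[of L u] assms by simp
  then have "inverse (L \<bullet> L) *\<^sub>R ((L \<bullet> L) *\<^sub>R u) = inverse (L \<bullet> L) *\<^sub>R (((\<i> * L) \<bullet> u) *\<^sub>R (\<i> * L))"
    by metis
  then show "u = (((\<i> * L) \<bullet> u) / (L \<bullet> L)) *\<^sub>R (\<i> * L)"
    using assms(1) by (simp add: field_simps)
qed

lemma line_eq_level_set:
  assumes "L \<noteq> 0" "u \<noteq> 0" "L \<bullet> p = 1" "L \<bullet> u = 0"
  shows "line p u = {X. L \<bullet> X = 1}"
proof
  show "line p u \<subseteq> {X. L \<bullet> X = 1}"
    using assms by (auto simp: line_def inner_add_right)
  show "{X. L \<bullet> X = 1} \<subseteq> line p u"
  proof
    fix X assume "X \<in> {X. L \<bullet> X = 1}"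
    then have "L \<bullet> (X - p) = 0" using assms by (simp add: inner_diff_right)
    then obtain c where c: "X - p = c *\<^sub>R (\<i> * L)" using perp_imp_rotate assms(1) by blast
    obtain d where d: "u = d *\<^sub>R (\<i> * L)" using perp_imp_rotate assms by blast
    then have "d \<noteq> 0" using assms by auto
    then have "X - p = (c / d) *\<^sub>R u" using c d by simp
    then have "X = p + (c / d) *\<^sub>R u" by (simp add: algebra_simps)
    then show "X \<in> line p u" by (auto simp: line_def)
  qed
qed

text \<open>
  Without the normalisation of the normal vector, duality becomes bilinear: a point \<open>X\<close> lies on the
  line dual to \<open>L\<close> iff \<open>L \<bullet> X = 1\<close>, which is symmetric in \<open>L\<close> and \<open>X\<close>.
\<close>

lemma dual_iff: "dual l L \<longleftrightarrow> L \<noteq> 0 \<and> l = {X. L \<bullet> X = 1}"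
proof
  assume "dual l L"
  then show "L \<noteq> 0 \<and> l = {X. L \<bullet> X = 1}"
    by (auto simp: dual_def field_simps)
next
  assume L: "L \<noteq> 0 \<and> l = {X. L \<bullet> X = 1}"
  then show "dual l L"
    unfolding dual_def
    by (intro exI[of _ "L /\<^sub>R norm L"] exI[of _ "1 / norm L"]) (auto simp: field_simps)
qed

lemma dual_unique:
  assumes "dual l L" "dual l M"
  shows "L = M"
proof -
  \<comment> \<open>Evaluate both functionals at the feet of the perpendiculars from the origin.\<close>
  have L: "L \<noteq> 0" and M: "M \<noteq> 0" and eq: "{X. L \<bullet> X = 1} = {X. M \<bullet> X = 1}"
    using assms by (auto simp: dual_iff)
  have "L /\<^sub>R (L \<bullet> L) \<in> {X. L \<bullet> X = 1}" "M /\<^sub>R (M \<bullet> M) \<in> {X. M \<bullet> X = 1}"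
    using L M by auto
  then have "M \<bullet> (L /\<^sub>R (L \<bullet> L)) = 1" "L \<bullet> (M /\<^sub>R (M \<bullet> M)) = 1"
    using eq by blast+
  then have "M \<bullet> L = L \<bullet> L" "M \<bullet> L = M \<bullet> M"
    using L M by (simp_all add: field_simps inner_commute)
  then have "(L - M) \<bullet> (L - M) = 0"
    by (simp add: inner_diff_left inner_diff_right inner_commute)
  then show ?thesis by simp
qed

text \<open>
  The sign of an oriented line is thus the sign of its direction relative to its dual point turned
  by a right angle, with the moment \<open>cross z u\<close> as the factor.
\<close>

lemma oriented_line_direction:
  assumes "is_oriented_line (l, u)" "dual l A" "z \<in> l"
  shows "u = cross z u *\<^sub>R (\<i> * A)" "A \<bullet> u = 0"
proof -
  obtain p where p: "l = line p u" and u: "norm u = 1"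
    using assms(1) by (auto simp: is_oriented_line_def)
  have l: "l = {X. A \<bullet> X = 1}" and A: "A \<noteq> 0" using assms(2) by (auto simp: dual_iff)
  have "p \<in> l" "p + u \<in> l"
    unfolding p line_def by (auto intro: range_eqI[of _ _ 0] range_eqI[of _ _ 1])
  then show u0: "A \<bullet> u = 0" unfolding l by (simp add: inner_add_right)
  obtain c where c: "u = c *\<^sub>R (\<i> * A)" using perp_imp_rotate A u0 by blast
  have "cross z u = c * (A \<bullet> z)"
    unfolding c cross_def by (simp add: inner_complex_def algebra_simps)
  then show "u = cross z u *\<^sub>R (\<i> * A)" using c assms(3) l by simp
qed

text \<open>
  The law of reflection for directions, rewritten for normals. The maps \<open>reflect v\<close> and
  \<open>reflect T\<close> for perpendicular \<open>v\<close> and \<open>T\<close> are negatives of each other, and turning by a right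
  angle anticommutes with a reflection.
\<close>

lemma reflect_perp_rotate:
  assumes "T \<noteq> 0" "v \<noteq> 0" "T \<bullet> v = 0"
  shows "reflect v (\<i> * A) = \<i> * reflect T A"
proof -
  obtain c where v: "v = c *\<^sub>R (\<i> * T)" using perp_imp_rotate assms by blast
  then have c: "c \<noteq> 0" using assms by auto
  have "v \<bullet> (\<i> * A) = c * (T \<bullet> A)" "v \<bullet> v = c\<^sup>2 * (T \<bullet> T)"
    unfolding v by (auto simp: inner_complex_def algebra_simps power2_eq_square)
  then show ?thesis
    unfolding reflect_def using c unfolding v
    by (simp add: power2_eq_square algebra_simps)
qed

lemma reflect_normal_component:
  assumes "T \<bullet> v = 0"
  shows "T \<bullet> reflect v u = - (T \<bullet> u)"
  using assms by (simp add: reflect_def inner_diff_right)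

lemma reflect_scaleR: "reflect v (c *\<^sub>R x) = c *\<^sub>R reflect v x"
  by (simp add: reflect_def algebra_simps)

lemma reflect_minus: "reflect v (- x) = - reflect v x"
  by (simp add: reflect_def algebra_simps)

lemma reflect_reflect: "v \<noteq> 0 \<Longrightarrow> reflect v (reflect v x) = x"
  by (simp add: reflect_def inner_diff_right algebra_simps)

lemma norm_reflect: "v \<noteq> 0 \<Longrightarrow> norm (reflect v x) = norm x"
proof -
  assume v: "v \<noteq> 0"
  have "(reflect v x) \<bullet> (reflect v x) = x \<bullet> x"
    using v by (simp add: reflect_def inner_diff_right inner_diff_left inner_commute field_simps)
  then show ?thesis by (simp add: norm_eq_sqrt_inner)
qed

lemma cross_reflect: "T \<noteq> 0 \<Longrightarrow> cross T (reflect T A) = - cross T A"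
  by (simp add: reflect_def cross_def algebra_simps)

lemma line_minus: "line p (- u) = line p u"
proof -
  have "line p (- v) \<subseteq> line p v" for v
    unfolding line_def
  proof clarify
    fix s :: real
    show "p + s *\<^sub>R - v \<in> range (\<lambda>s. p + s *\<^sub>R v)"
      by (rule range_eqI[of _ _ "- s"]) simp
  qed
  from this[of u] this[of "- u"] show ?thesis by auto
qed

lemma line_rebase:
  assumes "q \<in> line p u"
  shows "line p u = line q u"
proof -
  obtain r where q: "q = p + r *\<^sub>R u" using assms by (auto simp: line_def)
  show ?thesis
  proof
    show "line p u \<subseteq> line q u"
      unfolding line_def q
    proof clarify
      fix s :: real
      show "p + s *\<^sub>R u \<in> range (\<lambda>s. p + r *\<^sub>R u + s *\<^sub>R u)"
        by (rule range_eqI[of _ _ "s - r"]) (simp add: algebra_simps)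
    qed
    show "line q u \<subseteq> line p u"
      unfolding line_def q
    proof clarify
      fix s :: real
      show "p + r *\<^sub>R u + s *\<^sub>R u \<in> range (\<lambda>s. p + s *\<^sub>R u)"
        by (rule range_eqI[of _ _ "r + s"]) (simp add: algebra_simps)
    qed
  qed
qed

lemma fst_reverse [simp]: "fst (reverse l) = fst l"
  by (simp add: reverse_def split: prod.split)

lemma reverse_reverse [simp]: "reverse (reverse l) = l"
  by (simp add: reverse_def split: prod.split)

lemma is_oriented_line_reverse: "is_oriented_line (reverse l) \<longleftrightarrow> is_oriented_line l"
  by (auto simp: is_oriented_line_def reverse_def line_minus split: prod.splits)

lemma positive_reverse: "positive_line (reverse l) \<longleftrightarrow> negative_line l"
  by (auto simp: positive_line_def negative_line_def reverse_def cross_def split: prod.splits)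

section \<open>Angular reflection at a tangency point\<close>

text \<open>
  The point \<open>q\<close> is dual to the line \<open>AT\<close>. With it, the geometric construction of the angular map
  reduces to normalising \<open>reflect T A\<close> by its value under \<open>q\<close>.
\<close>

lemma angular_of_tangency_point:
  assumes T: "tangency_point \<Gamma> A = T" and "T \<noteq> 0" "A \<noteq> T" and q: "q \<bullet> A = 1" "q \<bullet> T = 1"
  shows angular_singular_iff: "A \<in> angular_singular \<Gamma> \<longleftrightarrow> A \<in> outside \<Gamma> \<and> q \<bullet> reflect T A = 0"
    and angular_eq: "q \<bullet> reflect T A \<noteq> 0 \<Longrightarrow> angular \<Gamma> A = reflect T A /\<^sub>R (q \<bullet> reflect T A)"
proof -
  let ?A' = "reflect T A"
  have A0: "A \<noteq> 0" and q0: "q \<noteq> 0" using q by auto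
  have A'0: "?A' \<noteq> 0" using norm_reflect[of T A] A0 assms(2) by auto
  have hull: "affine hull {A, T} = {X. q \<bullet> X = 1}"
  proof -
    have "affine hull {A, T} = line A (T - A)"
      by (simp add: affine_hull_2_alt line_def)
    also have "\<dots> = {X. q \<bullet> X = 1}"
      using line_eq_level_set[of q "T - A" A] q0 q assms(3) by (simp add: inner_diff_right)
    finally show ?thesis .
  qed
  have sym: "symmetric_line \<Gamma> A = range (\<lambda>s. s *\<^sub>R ?A')"
    unfolding symmetric_line_def T affine_hull_2_alt image_image
    by (simp add: reflect_scaleR)
  have par: "affine_parallel (range (\<lambda>s. s *\<^sub>R ?A')) {X. q \<bullet> X = 1} \<longleftrightarrow> q \<bullet> ?A' = 0"
  proof
    assume "affine_parallel (range (\<lambda>s. s *\<^sub>R ?A')) {X. q \<bullet> X = 1}"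
    then obtain a where a: "{X. q \<bullet> X = 1} = (\<lambda>x. a + x) ` range (\<lambda>s. s *\<^sub>R ?A')"
      by (auto simp: affine_parallel_def)
    have "a + 0 *\<^sub>R ?A' \<in> {X. q \<bullet> X = 1}" "a + 1 *\<^sub>R ?A' \<in> {X. q \<bullet> X = 1}"
      unfolding a by blast+
    then show "q \<bullet> ?A' = 0" by (simp add: inner_add_right)
  next
    assume "q \<bullet> ?A' = 0"
    then have "line A ?A' = {X. q \<bullet> X = 1}"
      using line_eq_level_set[of q ?A' A] q0 q A'0 by simp
    then have "{X. q \<bullet> X = 1} = (\<lambda>x. A + x) ` range (\<lambda>s. s *\<^sub>R ?A')"
      by (simp add: line_def image_image)
    then show "affine_parallel (range (\<lambda>s. s *\<^sub>R ?A')) {X. q \<bullet> X = 1}"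
      by (auto simp: affine_parallel_def)
  qed
  show "A \<in> angular_singular \<Gamma> \<longleftrightarrow> A \<in> outside \<Gamma> \<and> q \<bullet> ?A' = 0"
    by (simp add: angular_singular_def sym T hull par)
  show "angular \<Gamma> A = ?A' /\<^sub>R (q \<bullet> ?A')" if "q \<bullet> ?A' \<noteq> 0"
    unfolding angular_def sym T hull
  proof (rule the_equality)
    show "?A' /\<^sub>R (q \<bullet> ?A') \<in> range (\<lambda>s. s *\<^sub>R ?A') \<inter> {X. q \<bullet> X = 1}"
      using that by auto
    fix B assume "B \<in> range (\<lambda>s. s *\<^sub>R ?A') \<inter> {X. q \<bullet> X = 1}"
    then obtain s where s: "B = s *\<^sub>R ?A'" and "q \<bullet> B = 1" by blast
    then have "s * (q \<bullet> ?A') = 1" by simp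
    with s show "B = ?A' /\<^sub>R (q \<bullet> ?A')" using that by (simp add: field_simps)
  qed
qed

text \<open>
  For \<open>B = reflect T A /\<^sub>R k\<close> one has \<open>A + k *\<^sub>R B = (1 + k) *\<^sub>R T\<close>, since \<open>A + reflect T A\<close> is a
  multiple of \<open>T\<close>. For positive \<open>k\<close> this is a convex combination. For negative \<open>k\<close> both endpoints
  lie strictly on the same side of the line \<open>OT\<close>.
\<close>

lemma tangency_point_in_segment_iff:
  assumes "T \<noteq> 0" "cross T A \<noteq> 0" and q: "q \<bullet> A = 1" "q \<bullet> T = 1" and k: "k = q \<bullet> reflect T A" "k \<noteq> 0"
  shows "T \<in> closed_segment A (reflect T A /\<^sub>R k) \<longleftrightarrow> k > 0"
proof
  let ?B = "reflect T A /\<^sub>R k"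
  have sum: "A + k *\<^sub>R ?B = (1 + k) *\<^sub>R T"
    using k q by (simp add: reflect_def inner_diff_right)
  {
    assume "k > 0"
    then have "T = (1 / (1 + k)) *\<^sub>R (A + k *\<^sub>R ?B)"
      unfolding sum by simp
    also have "\<dots> = (1 - k / (1 + k)) *\<^sub>R A + (k / (1 + k)) *\<^sub>R ?B"
      using \<open>k > 0\<close> by (simp add: scaleR_add_right field_simps)
    finally show "T \<in> closed_segment A ?B"
      unfolding in_segment using \<open>k > 0\<close> by (intro exI[of _ "k / (1 + k)"]) auto
  }
  assume "T \<in> closed_segment A ?B"
  then obtain \<theta> where \<theta>: "0 \<le> \<theta>" "\<theta> \<le> 1" "T = (1 - \<theta>) *\<^sub>R A + \<theta> *\<^sub>R ?B"
    by (auto simp: in_segment)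
  have lin: "cross T ((1 - \<theta>) *\<^sub>R A + \<theta> *\<^sub>R ?B)
      = (1 - \<theta>) * cross T A + \<theta> / k * cross T (reflect T A)"
    by (simp add: cross_def algebra_simps divide_inverse)
  have "cross T T = 0" by (simp add: cross_def)
  then have "(1 - \<theta>) * cross T A + \<theta> / k * cross T (reflect T A) = 0"
    using lin unfolding \<theta>(3)[symmetric] by simp
  then have "((1 - \<theta>) - \<theta> / k) * cross T A = 0"
    unfolding cross_reflect[OF assms(1)] by (simp add: algebra_simps)
  then have "(1 - \<theta>) - \<theta> / k = 0" using assms(2) by simp
  then have "(1 - \<theta>) * k = \<theta>" using k(2) by (simp add: field_simps)
  then have "(1 - \<theta>) * k \<ge> 0" "\<theta> \<noteq> 1" using \<theta>(1) k(2) by auto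
  then show "k > 0"
    using \<theta>(2) k(2) by (simp add: zero_le_mult_iff)
qed

section \<open>Billiard tables and their dual curves\<close>

locale billiard_table =
  fixes \<gamma> :: "real \<Rightarrow> complex"
  assumes curve: "smooth_convex_closed_curve \<gamma>"
    and origin: "0 \<in> inside (path_image \<gamma>)"
begin

abbreviation table :: "complex set" where
  "table \<equiv> inside (path_image \<gamma>)"

abbreviation velocity :: "real \<Rightarrow> complex" where
  "velocity t \<equiv> vector_derivative \<gamma> (at t)"

lemma simple: "simple_path \<gamma>" and closed_path: "pathfinish \<gamma> = pathstart \<gamma>"
  and convex_table: "convex table"
proof -
  show "simple_path \<gamma>" "convex table" using curve by (auto simp: smooth_convex_closed_curve_def)
  have "\<gamma> (0 + 1) = \<gamma> 0" using curve unfolding smooth_convex_closed_curve_def by blast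
  then show "pathfinish \<gamma> = pathstart \<gamma>" by (simp add: pathfinish_def pathstart_def)
qed

lemma open_table: "open table" and bounded_table: "bounded table"
  and frontier_table: "frontier table = path_image \<gamma>"
  using Jordan_inside_outside[OF simple closed_path] by auto

lemma table_disjoint: "table \<inter> path_image \<gamma> = {}"
  by (simp add: inside_no_overlap)

lemma velocity_nonzero: "velocity t \<noteq> 0"
  using curve by (auto simp: smooth_convex_closed_curve_def)

lemma has_velocity: "(\<gamma> has_vector_derivative velocity t) (at t)"
proof -
  obtain D where "D 0 = \<gamma>" "\<And>n t. (D n has_vector_derivative D (Suc n) t) (at t)"
    using curve unfolding smooth_convex_closed_curve_def smooth_def by blast
  then have "(\<gamma> has_vector_derivative D 1 t) (at t)" by (metis One_nat_def)
  then show ?thesis using vector_derivative_at by force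
qed

lemma curve_point: "\<gamma> t \<in> path_image \<gamma>"
proof -
  have per: "\<gamma> (s + 1) = \<gamma> s" for s using curve by (auto simp: smooth_convex_closed_curve_def)
  have "\<gamma> (s + of_int k) = \<gamma> s" for s k
  proof (induction k rule: int_induct[of _ 0])
    case (step1 i)
    then show ?case using per[of "s + of_int i"] by (simp add: algebra_simps)
  next
    case (step2 i)
    then show ?case using per[of "s + of_int (i - 1)"] by (simp add: algebra_simps)
  qed simp
  from this[of "frac t" "\<lfloor>t\<rfloor>"] have "\<gamma> t = \<gamma> (frac t)" by (simp add: frac_def)
  moreover have "frac t \<in> {0..1}" using frac_lt_1[of t] by simp
  ultimately show ?thesis unfolding path_image_def by (metis imageI)
qed

lemma curve_in_closure: "\<gamma> t \<in> closure table"
  using curve_point frontier_table by (auto simp: frontier_def)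

lemma curve_not_in_table: "\<gamma> t \<notin> table"
  using curve_point table_disjoint by blast

text \<open>
  A nonzero functional has no maximum on an open set.
\<close>

lemma table_inner_less:
  assumes "a \<noteq> 0" "\<And>X. X \<in> table \<Longrightarrow> a \<bullet> X \<le> b" "X \<in> table"
  shows "a \<bullet> X < b"
proof -
  obtain e where e: "e > 0" "ball X e \<subseteq> table"
    using open_table assms(3) open_contains_ball by blast
  define d where "d = e / (2 * norm a)"
  have d: "d > 0" "d * norm a < e" using e assms(1) by (auto simp: d_def)
  then have "X + d *\<^sub>R a \<in> table" using e by (auto simp: dist_norm)
  then have "a \<bullet> (X + d *\<^sub>R a) \<le> b" using assms(2) by blast
  moreover have "a \<bullet> (X + d *\<^sub>R a) > a \<bullet> X" using d assms(1) by (simp add: inner_add_right)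
  ultimately show ?thesis by linarith
qed

lemma closure_inner_le:
  assumes "\<And>X. X \<in> table \<Longrightarrow> a \<bullet> X \<le> b" "X \<in> closure table"
  shows "a \<bullet> X \<le> b"
proof -
  have "closure table \<subseteq> {X. a \<bullet> X \<le> b}"
    by (rule closure_minimal) (use assms closed_halfspace_le in auto)
  then show ?thesis using assms by auto
qed

text \<open>
  Here the smoothness of the curve enters: the functional \<open>a\<close> along the curve has a maximum at
  \<open>t\<close>, so its derivative there vanishes.
\<close>

lemma touching_normal:
  assumes "\<And>X. X \<in> table \<Longrightarrow> a \<bullet> X \<le> a \<bullet> \<gamma> t"
  shows "a \<bullet> velocity t = 0"
proof (rule DERIV_local_max)
  have "((\<lambda>s. a \<bullet> \<gamma> s) has_derivative (\<lambda>h. a \<bullet> (h *\<^sub>R velocity t))) (at t)"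
    using has_velocity[of t] unfolding has_vector_derivative_def
    by (rule has_derivative_inner_right)
  then show "((\<lambda>s. a \<bullet> \<gamma> s) has_real_derivative a \<bullet> velocity t) (at t)"
    unfolding has_field_derivative_def
    by (rule has_derivative_eq_rhs) (simp add: fun_eq_iff mult.commute)
  show "\<forall>s. \<bar>t - s\<bar> < 1 \<longrightarrow> a \<bullet> \<gamma> s \<le> a \<bullet> \<gamma> t"
    using closure_inner_le[OF assms curve_in_closure] by blast
qed simp

lemma touching_imp_dual_tangent:
  assumes "\<And>X. X \<in> table \<Longrightarrow> T \<bullet> X \<le> 1" "T \<bullet> \<gamma> t = 1"
  shows "dual (tangent_line \<gamma> t) T"
proof -
  have "T \<noteq> 0" using assms by auto
  moreover have "T \<bullet> velocity t = 0" by (rule touching_normal) (use assms in auto)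
  ultimately show ?thesis
    using line_eq_level_set[of T "velocity t" "\<gamma> t"] velocity_nonzero assms(2)
    by (simp add: dual_iff tangent_line_def)
qed

text \<open>
  The tangent line at \<open>\<gamma> t\<close> is the only candidate for a separating line between the table and a
  convex set containing \<open>\<gamma> t\<close>. For \<open>C = {\<gamma> t}\<close> this says that tangent lines support the table;
  for a ray \<open>C\<close> it shows that a direction pointing to the inner side of the tangent really enters
  the table.
\<close>

lemma tangent_separates:
  assumes "convex C" "\<gamma> t \<in> C" "C \<inter> table = {}"
  obtains T where "dual (tangent_line \<gamma> t) T" "\<And>X. X \<in> table \<Longrightarrow> T \<bullet> X < 1"
    "\<And>X. X \<in> C \<Longrightarrow> T \<bullet> X \<ge> 1"
proof -
  \<comment> \<open>Dividing the separating functional by its bound \<open>b\<close>, positive since the table contains the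
    origin, turns it into a dual point.\<close>
  obtain a b where ab: "a \<noteq> 0" "\<And>X. X \<in> table \<Longrightarrow> a \<bullet> X \<le> b" "\<And>X. X \<in> C \<Longrightarrow> a \<bullet> X \<ge> b"
    using separating_hyperplane_sets[of table C] convex_table assms origin by blast
  have "a \<bullet> \<gamma> t \<le> b" using closure_inner_le ab(2) curve_in_closure by blast
  then have b: "a \<bullet> \<gamma> t = b" using ab(3) assms(2) by force
  have lt: "a \<bullet> X < b" if "X \<in> table" for X using table_inner_less ab that by blast
  from lt[OF origin] have "b > 0" by simp
  have lt1: "(a /\<^sub>R b) \<bullet> X < 1" if "X \<in> table" for X
    using lt[OF that] \<open>b > 0\<close> by (simp add: field_simps)
  moreover have "dual (tangent_line \<gamma> t) (a /\<^sub>R b)"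
    by (rule touching_imp_dual_tangent) (use lt1 b \<open>b > 0\<close> in \<open>auto intro: less_imp_le\<close>)
  moreover have "(a /\<^sub>R b) \<bullet> X \<ge> 1" if "X \<in> C" for X
    using ab(3)[OF that] \<open>b > 0\<close> by (simp add: field_simps)
  ultimately show ?thesis using that by blast
qed

lemma dual_tangent:
  assumes "dual (tangent_line \<gamma> t) T"
  shows "T \<noteq> 0" "T \<bullet> \<gamma> t = 1" "T \<bullet> velocity t = 0" "\<And>X. X \<in> table \<Longrightarrow> T \<bullet> X < 1"
    "\<And>X. X \<in> closure table \<Longrightarrow> T \<bullet> X \<le> 1"
proof -
  obtain T' where T': "dual (tangent_line \<gamma> t) T'" "\<And>X. X \<in> table \<Longrightarrow> T' \<bullet> X < 1"
    using tangent_separates[of "{\<gamma> t}" t] curve_not_in_table by (metis Int_insert_left_if0 Int_empty_left convex_singleton singletonI)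
  have "T = T'" using dual_unique assms T' by blast
  then show lt: "T \<bullet> X < 1" if "X \<in> table" for X using T' that by blast
  then show "T \<bullet> X \<le> 1" if "X \<in> closure table" for X
    using closure_inner_le that by (meson less_imp_le)
  have l: "line (\<gamma> t) (velocity t) = {X. T \<bullet> X = 1}" and T0: "T \<noteq> 0"
    using assms by (auto simp: dual_iff tangent_line_def)
  have "\<gamma> t \<in> line (\<gamma> t) (velocity t)" "\<gamma> t + velocity t \<in> line (\<gamma> t) (velocity t)"
    unfolding line_def by (auto intro: range_eqI[of _ _ 0] range_eqI[of _ _ 1])
  then show "T \<noteq> 0" "T \<bullet> \<gamma> t = 1" "T \<bullet> velocity t = 0"
    using T0 unfolding l by (auto simp: inner_add_right)
qed

lemma dual_tangent_exists: obtains T where "dual (tangent_line \<gamma> t) T"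
  using tangent_separates[of "{\<gamma> t}" t] curve_not_in_table
  by (metis Int_insert_left_if0 Int_empty_left convex_singleton singletonI)

text \<open>
  The convex set enclosed by the dual curve. Every topological fact about the dual curve is obtained
  from this set, without parametrising the dual curve.
\<close>

definition polar :: "complex set" where
  "polar = {L. \<forall>X\<in>table. L \<bullet> X \<le> 1}"

lemma polar_eq_Inter: "polar = (\<Inter>X\<in>table. {L. X \<bullet> L \<le> 1})"
  by (auto simp: polar_def inner_commute)

lemma closed_polar: "closed polar"
  unfolding polar_eq_Inter by (auto intro: closed_halfspace_le)

lemma convex_polar: "convex polar"
  unfolding polar_eq_Inter by (auto intro: convex_INT convex_halfspace_le)

lemma bounded_polar: "bounded polar"
proof -
  obtain e where e: "e > 0" "cball 0 e \<subseteq> table"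
    using open_table origin open_contains_cball by blast
  have "norm L \<le> 1 / e" if "L \<in> polar" for L
  proof (cases "L = 0")
    case False
    then have "(e / norm L) *\<^sub>R L \<in> table" using e by (auto simp: subset_iff)
    then have "L \<bullet> ((e / norm L) *\<^sub>R L) \<le> 1" using that by (auto simp: polar_def)
    then show ?thesis using False e by (simp add: dot_square_norm power2_eq_square field_simps)
  qed (use e in auto)
  then show ?thesis by (auto simp: bounded_iff)
qed

text \<open>
  Both sides consist of the functionals whose maximum on the closed table is \<open>1\<close>: such a
  functional touches the table at a curve point and so is dual to the tangent there; if the maximum
  is smaller, boundedness of the table leaves room for a whole ball inside the polar set.
\<close>

lemma dual_curve_eq_frontier_polar: "dual_curve \<gamma> = frontier polar"
proof (intro set_eqI iffI)
  fix L assume "L \<in> dual_curve \<gamma>"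
  then obtain t where "dual (tangent_line \<gamma> t) L" by (auto simp: dual_curve_def)
  note L = dual_tangent[OF this]
  have "L \<in> polar" using L(4) by (auto simp: polar_def intro: less_imp_le)
  moreover have "L \<notin> interior polar"
  proof
    assume "L \<in> interior polar"
    then obtain e where e: "e > 0" "cball L e \<subseteq> polar" by (auto simp: mem_interior_cball)
    \<comment> \<open>Moving radially outwards would raise the value at the touching point above \<open>1\<close>.\<close>
    have "L + (e / norm L) *\<^sub>R L \<in> cball L e" using e L(1) by (auto simp: dist_norm)
    then have "(L + (e / norm L) *\<^sub>R L) \<bullet> \<gamma> t \<le> 1"
      using e closure_inner_le[OF _ curve_in_closure] unfolding polar_def by blast
    then show False using e L(1,2) by (simp add: inner_add_left field_simps)
  qed
  ultimately show "L \<in> frontier polar" using closed_polar by (simp add: frontier_def)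
next
  fix L assume "L \<in> frontier polar"
  then have L: "L \<in> polar" "L \<notin> interior polar" using closed_polar by (auto simp: frontier_def)
  have "compact (closure table)" using bounded_table by (simp add: compact_closure)
  moreover have "closure table \<noteq> {}" using origin closure_subset by blast
  moreover have "continuous_on (closure table) (\<lambda>X. L \<bullet> X)" by (intro continuous_intros)
  ultimately obtain X0 where X0: "X0 \<in> closure table" "\<And>X. X \<in> closure table \<Longrightarrow> L \<bullet> X \<le> L \<bullet> X0"
    using continuous_attains_sup by metis
  obtain R where R: "R > 0" "\<And>X. X \<in> table \<Longrightarrow> norm X \<le> R"
    using bounded_table bounded_pos by metis
  have "L \<bullet> X0 \<ge> 1"
  proof (rule ccontr)
    assume "\<not> L \<bullet> X0 \<ge> 1"
    then have d: "(1 - L \<bullet> X0) / R > 0" using R by simp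
    have "ball L ((1 - L \<bullet> X0) / R) \<subseteq> polar"
    proof
      fix M assume "M \<in> ball L ((1 - L \<bullet> X0) / R)"
      then have M: "norm (M - L) * R \<le> 1 - L \<bullet> X0"
        using R by (simp add: dist_norm norm_minus_commute field_simps)
      have "M \<bullet> X \<le> 1" if "X \<in> table" for X
      proof -
        have "(M - L) \<bullet> X \<le> norm (M - L) * norm X" by (rule norm_cauchy_schwarz)
        also have "\<dots> \<le> norm (M - L) * R" using R(2)[OF that] by (intro mult_left_mono) auto
        finally have "(M - L) \<bullet> X \<le> 1 - L \<bullet> X0" using M by simp
        moreover have "L \<bullet> X \<le> L \<bullet> X0" using X0 that closure_subset by blast
        ultimately show ?thesis by (simp add: inner_diff_left)
      qed
      then show "M \<in> polar" by (auto simp: polar_def)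
    qed
    then have "L \<in> interior polar" using d by (meson mem_interior)
    then show False using L by blast
  qed
  moreover have le: "L \<bullet> X \<le> 1" if "X \<in> table" for X using L that by (auto simp: polar_def)
  ultimately have X01: "L \<bullet> X0 = 1" using closure_inner_le[OF _ X0(1)] by force
  have "X0 \<notin> table" using table_inner_less[of L 1 X0] le X01 by fastforce
  then have "X0 \<in> path_image \<gamma>"
    using X0(1) frontier_table open_table by (auto simp: frontier_def interior_open)
  then obtain t where "X0 = \<gamma> t" by (auto simp: path_image_def)
  then have "dual (tangent_line \<gamma> t) L" using touching_imp_dual_tangent le X01 by blast
  then show "L \<in> dual_curve \<gamma>" by (auto simp: dual_curve_def)
qed

text \<open>
  A functional leaves the polar set when it exceeds \<open>1\<close> somewhere on the table. As it is \<open>0\<close> at the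
  origin and the table is convex, it then also takes the value \<open>1\<close> there.
\<close>

lemma outside_dual_curve_iff:
  assumes "dual l A"
  shows "A \<in> outside (dual_curve \<gamma>) \<longleftrightarrow> l \<inter> table \<noteq> {}"
proof -
  have l: "l = {X. A \<bullet> X = 1}" and A0: "A \<noteq> 0" using assms by (auto simp: dual_iff)
  have "outside (dual_curve \<gamma>) = - polar"
    unfolding dual_curve_eq_frontier_polar
    using outside_frontier_eq_complement_closure[OF bounded_polar convex_polar] closed_polar by simp
  then have "A \<in> outside (dual_curve \<gamma>) \<longleftrightarrow> (\<exists>X\<in>table. A \<bullet> X > 1)"
    by (auto simp: polar_def not_le)
  also have "\<dots> \<longleftrightarrow> l \<inter> table \<noteq> {}"
  proof
    assume "\<exists>X\<in>table. A \<bullet> X > 1"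
    then obtain X where X: "X \<in> table" "A \<bullet> X > 1" by blast
    have "(1 / (A \<bullet> X)) *\<^sub>R X + (1 - 1 / (A \<bullet> X)) *\<^sub>R 0 \<in> table"
      by (rule convexD[OF convex_table X(1) origin]) (use X in auto)
    moreover have "A \<bullet> ((1 / (A \<bullet> X)) *\<^sub>R X) = 1" using X by simp
    ultimately show "l \<inter> table \<noteq> {}"
      unfolding l by (metis Int_iff add.right_neutral empty_iff mem_Collect_eq scaleR_zero_right)
  next
    assume "l \<inter> table \<noteq> {}"
    then obtain X where "X \<in> table" "A \<bullet> X = 1" by (auto simp: l)
    then show "\<exists>X\<in>table. A \<bullet> X > 1"
      using table_inner_less[of A 1 X] A0 by force
  qed
  finally show ?thesis .
qed

section \<open>The billiard map and its inverse\<close>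

lemma exit_exists:
  assumes "l \<in> billiard_lines \<gamma>"
  obtains t where "0 \<le> t" "t < 1" "exits_at \<gamma> l (\<gamma> t)"
proof -
  obtain S u where l: "l = (S, u)" by (cases l)
  obtain p where p: "p \<in> S" "p \<in> table" and u: "norm u = 1" "is_oriented_line (S, u)"
    using assms by (auto simp: billiard_lines_def l is_oriented_line_def)
  then have S: "S = line p u" using line_rebase by (auto simp: is_oriented_line_def)
  obtain d where d: "0 < d" "p + d *\<^sub>R u \<in> frontier table"
      "\<And>e. 0 \<le> e \<Longrightarrow> e < d \<Longrightarrow> p + e *\<^sub>R u \<in> interior table"
    using ray_to_frontier[OF bounded_table, of p u] open_table p u
    by (metis interior_open norm_zero zero_neq_one)
  obtain t where t: "t \<in> {0..1}" "p + d *\<^sub>R u = \<gamma> t"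
    using d(2) frontier_table unfolding path_image_def by auto
  \<comment> \<open>The parameters \<open>0\<close> and \<open>1\<close> give the same point; the exit parameter is taken from \<open>[0, 1)\<close>.\<close>
  define t' where "t' = (if t = 1 then 0 else t)"
  have t': "0 \<le> t'" "t' < 1" "p + d *\<^sub>R u = \<gamma> t'"
    using t closed_path by (auto simp: t'_def pathfinish_def pathstart_def)
  have "p + d *\<^sub>R u - s *\<^sub>R u \<in> table" if "0 < s" "s < d" for s
    using d(3)[of "d - s"] that open_table by (simp add: interior_open algebra_simps)
  moreover have "p + d *\<^sub>R u \<in> S \<inter> path_image \<gamma>" using d frontier_table S by (auto simp: line_def)
  ultimately have "exits_at \<gamma> l (\<gamma> t')"
    unfolding exits_at_def l t'(3)[symmetric] using d(1) by auto
  then show ?thesis using that t' by blast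
qed

text \<open>
  Beyond an exit point the line contains no point of the closed table: otherwise the exit point
  would lie strictly between an interior point and a point of the closure, and so in the open table.
\<close>

lemma exit_unique:
  assumes "is_oriented_line l" "exits_at \<gamma> l q" "exits_at \<gamma> l q'"
  shows "q = q'"
proof -
  obtain S u where l: "l = (S, u)" by (cases l)
  have ahead: False
    if q: "exits_at \<gamma> l q" and q': "exits_at \<gamma> l q'" and r: "q' = q + r *\<^sub>R u" "r > 0" for q q' r
  proof -
    obtain e where e: "e > 0" "\<And>s. 0 < s \<and> s < e \<Longrightarrow> q - s *\<^sub>R u \<in> table"
      using q unfolding exits_at_def l by auto
    define s where "s = e / 2"
    have s: "s > 0" "q - s *\<^sub>R u \<in> table" using e by (auto simp: s_def)
    have "q' \<in> closure table" using q' frontier_table by (auto simp: exits_at_def l frontier_def)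
    moreover have "q - s *\<^sub>R u \<in> interior table" using s open_table by (simp add: interior_open)
    ultimately have "q' - (r / (r + s)) *\<^sub>R (q' - (q - s *\<^sub>R u)) \<in> interior table"
      using s r by (intro mem_interior_closure_convex_shrink[OF convex_table]) auto
    also have "q' - (r / (r + s)) *\<^sub>R (q' - (q - s *\<^sub>R u)) = q"
    proof -
      have "q' - (q - s *\<^sub>R u) = (r + s) *\<^sub>R u" unfolding r by (simp add: algebra_simps)
      then show ?thesis using r s by simp
    qed
    finally have "q \<in> table" using interior_subset by blast
    moreover have "q \<in> path_image \<gamma>" using q by (auto simp: exits_at_def l)
    ultimately show False using table_disjoint by blast
  qed
  have "q \<in> S" "q' \<in> S" using assms by (auto simp: exits_at_def l)
  moreover then have "S = line q u"
    using assms line_rebase by (auto simp: is_oriented_line_def l)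
  ultimately obtain r where r: "q' = q + r *\<^sub>R u" by (auto simp: line_def)
  then have "q = q' + (- r) *\<^sub>R u" by simp
  then show ?thesis
    using ahead[OF assms(2,3) r] ahead[OF assms(3,2), of "- r"] r by (cases r "0::real" rule: linorder_cases) auto
qed

lemma exit_param_eq:
  assumes "is_oriented_line l" "0 \<le> t" "t < 1" "exits_at \<gamma> l (\<gamma> t)"
  shows "exit_param \<gamma> l = t"
  unfolding exit_param_def
proof (rule the_equality)
  fix s assume s: "0 \<le> s \<and> s < 1 \<and> exits_at \<gamma> l (\<gamma> s)"
  then have "\<gamma> s = \<gamma> t" using exit_unique assms by blast
  then show "s = t"
    using simple s assms unfolding simple_path_def loop_free_def by force
qed (use assms in auto)

lemma exit_direction:
  assumes "exits_at \<gamma> (S, u) (\<gamma> t)" "dual (tangent_line \<gamma> t) T"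
  shows "T \<bullet> u > 0"
proof -
  obtain e where e: "e > 0" "\<And>s. 0 < s \<and> s < e \<Longrightarrow> \<gamma> t - s *\<^sub>R u \<in> table"
    using assms unfolding exits_at_def by auto
  have "T \<bullet> (\<gamma> t - (e / 2) *\<^sub>R u) < 1" using dual_tangent(4)[OF assms(2)] e by auto
  then show ?thesis using dual_tangent(2)[OF assms(2)] e by (simp add: inner_diff_right zero_less_mult_iff)
qed

text \<open>
  If the ray missed the table, the tangent line would separate the two, and the ray could not point
  to the inner side of it.
\<close>

lemma inward_ray_enters:
  assumes "dual (tangent_line \<gamma> t) T" "T \<bullet> w < 0"
  obtains e where "e > 0" "\<And>s. 0 < s \<Longrightarrow> s < e \<Longrightarrow> \<gamma> t + s *\<^sub>R w \<in> table"
proof -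
  let ?C = "(\<lambda>s. \<gamma> t + s *\<^sub>R w) ` {0..}"
  have conv: "convex ?C"
  proof -
    have "convex ((+) (\<gamma> t) ` (\<lambda>s. s *\<^sub>R w) ` {0::real..})"
      by (intro convex_translation convex_linear_image) (auto intro: bounded_linear.linear bounded_linear_scaleR_left)
    then show ?thesis by (simp add: image_image)
  qed
  have "?C \<inter> table \<noteq> {}"
  proof
    assume "?C \<inter> table = {}"
    moreover have "\<gamma> t \<in> ?C" by (rule image_eqI[of _ _ 0]) auto
    ultimately obtain T' where T': "dual (tangent_line \<gamma> t) T'" "\<And>X. X \<in> ?C \<Longrightarrow> T' \<bullet> X \<ge> 1"
      using tangent_separates[OF conv] by metis
    have "T' = T" using T' assms dual_unique by blast
    moreover have "\<gamma> t + 1 *\<^sub>R w \<in> ?C" by (rule imageI) simp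
    ultimately have "T \<bullet> (\<gamma> t + 1 *\<^sub>R w) \<ge> 1" using T'(2) by blast
    then show False using assms dual_tangent(2)[OF assms(1)] by (simp add: inner_add_right)
  qed
  then obtain e where e: "e \<ge> 0" "\<gamma> t + e *\<^sub>R w \<in> table" by auto
  then have e0: "e > 0" using curve_not_in_table by (cases "e = 0") auto
  have "\<gamma> t + s *\<^sub>R w \<in> table" if "0 < s" "s < e" for s
  proof -
    have "\<gamma> t - (s / e) *\<^sub>R (\<gamma> t - (\<gamma> t + e *\<^sub>R w)) \<in> interior table"
      using e open_table that curve_in_closure
      by (intro mem_interior_closure_convex_shrink[OF convex_table]) (auto simp: interior_open)
    then show ?thesis using e0 interior_subset by auto
  qed
  then show ?thesis using that e0 by blast
qed

text \<open>
  Reversibility: the outgoing line traversed backwards exits at the same collision point, where the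
  reflection undoes itself.
\<close>

lemma birkhoff_collision:
  assumes "l \<in> billiard_lines \<gamma>"
  obtains t T where "exits_at \<gamma> l (\<gamma> t)" "dual (tangent_line \<gamma> t) T"
    "birkhoff \<gamma> l = (line (\<gamma> t) (reflect (velocity t) (snd l)), reflect (velocity t) (snd l))"
    "birkhoff \<gamma> l \<in> billiard_lines \<gamma>"
    "birkhoff \<gamma> (reverse (birkhoff \<gamma> l)) = reverse l"
proof -
  obtain S u where l: "l = (S, u)" by (cases l)
  have ori: "is_oriented_line l" using assms by (simp add: billiard_lines_def)
  obtain t where t: "0 \<le> t" "t < 1" "exits_at \<gamma> l (\<gamma> t)" using exit_exists assms by blast
  obtain T where T: "dual (tangent_line \<gamma> t) T" using dual_tangent_exists .
  define w where "w = reflect (velocity t) u"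
  have S: "S = line (\<gamma> t) u"
    using ori t(3) line_rebase by (auto simp: is_oriented_line_def exits_at_def l)
  have B: "birkhoff \<gamma> l = (line (\<gamma> t) w, w)"
    unfolding l birkhoff_def using exit_param_eq[OF ori t] by (simp add: l w_def Let_def)
  have nw: "norm w = 1"
    using norm_reflect velocity_nonzero ori by (simp add: w_def is_oriented_line_def l)
  have oriB: "is_oriented_line (birkhoff \<gamma> l)" using nw by (auto simp: B is_oriented_line_def)
  have "T \<bullet> w < 0"
    using exit_direction[of S u t T] t(3) T reflect_normal_component[OF dual_tangent(3)[OF T]]
    by (simp add: l w_def)
  then obtain e where e: "e > 0" "\<And>s. 0 < s \<Longrightarrow> s < e \<Longrightarrow> \<gamma> t + s *\<^sub>R w \<in> table"
    using inward_ray_enters T by blast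
  have "\<gamma> t + (e / 2) *\<^sub>R w \<in> line (\<gamma> t) w \<inter> table" using e by (auto simp: line_def)
  then have mem: "birkhoff \<gamma> l \<in> billiard_lines \<gamma>"
    using oriB by (auto simp: billiard_lines_def B)
  have "\<gamma> t \<in> line (\<gamma> t) w" unfolding line_def by (rule range_eqI[of _ _ 0]) simp
  then have "exits_at \<gamma> (reverse (birkhoff \<gamma> l)) (\<gamma> t)"
    unfolding B reverse_def exits_at_def using curve_point e by auto
  then have "exit_param \<gamma> (line (\<gamma> t) w, - w) = t"
    using exit_param_eq[OF _ t(1,2)] oriB is_oriented_line_reverse[of "birkhoff \<gamma> l"]
    by (simp add: reverse_def B)
  moreover have "reflect (velocity t) w = u"
    by (simp add: w_def reflect_reflect velocity_nonzero)
  ultimately have "birkhoff \<gamma> (line (\<gamma> t) w, - w) = (line (\<gamma> t) u, - u)"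
    by (simp add: birkhoff_def Let_def reflect_minus line_minus)
  then have "birkhoff \<gamma> (reverse (birkhoff \<gamma> l)) = reverse l"
    unfolding B by (simp add: reverse_def l S)
  then show ?thesis using that[of t T] t T S B mem by (simp add: l w_def)
qed

lemma reverse_in_billiard_lines: "reverse l \<in> billiard_lines \<gamma> \<longleftrightarrow> l \<in> billiard_lines \<gamma>"
  by (simp add: billiard_lines_def is_oriented_line_reverse)

lemma inv_birkhoff:
  assumes "l \<in> billiard_lines \<gamma>"
  shows "inv_into (billiard_lines \<gamma>) (birkhoff \<gamma>) l = reverse (birkhoff \<gamma> (reverse l))"
proof -
  have rev: "birkhoff \<gamma> m \<in> billiard_lines \<gamma>" "birkhoff \<gamma> (reverse (birkhoff \<gamma> m)) = reverse m"
    if "m \<in> billiard_lines \<gamma>" for m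
    using birkhoff_collision[OF that] by metis+
  have "inj_on (birkhoff \<gamma>) (billiard_lines \<gamma>)"
    by (rule inj_onI) (metis rev(2) reverse_reverse)
  moreover have "reverse (birkhoff \<gamma> (reverse l)) \<in> billiard_lines \<gamma>"
    using assms rev(1) reverse_in_billiard_lines by blast
  moreover have "birkhoff \<gamma> (reverse (birkhoff \<gamma> (reverse l))) = l"
    using assms rev(2)[of "reverse l"] reverse_in_billiard_lines by simp
  ultimately show ?thesis using inv_into_f_eq by metis
qed

section \<open>The two maps correspond\<close>

text \<open>
  The points \<open>A\<close> and \<open>T\<close> both have value \<open>1\<close> under \<open>q = \<gamma> t\<close>, so \<open>T - A = c *\<^sub>R (\<i> * q)\<close> and
  \<open>cross (T - A) (X - A) = c * (1 - X \<bullet> q)\<close>. The last factor is nonnegative on the dual curve, and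
  \<open>c\<close> has the sign of the line, because the direction \<open>u\<close> leaves the table through the tangent
  dual to \<open>T\<close>.
\<close>

lemma positive_tangent_at_exit:
  assumes ori: "is_oriented_line (S, u)" and A: "dual S A" and pos: "positive_line (S, u)"
    and ex: "exits_at \<gamma> (S, u) (\<gamma> t)" and T: "dual (tangent_line \<gamma> t) T"
  shows "positive_tangent (dual_curve \<gamma>) A l T' \<longleftrightarrow> T' = T \<and> l = affine hull {A, T}"
proof -
  note T' = dual_tangent[OF T]
  have qS: "\<gamma> t \<in> S" using ex by (auto simp: exits_at_def)
  then have qA: "A \<bullet> \<gamma> t = 1" using A by (auto simp: dual_iff)
  let ?k = "cross (\<gamma> t) u"
  have k: "?k > 0" using pos qS by (auto simp: positive_line_def)
  have Au: "A \<bullet> u = 0" using oriented_line_direction[OF ori A qS] by blast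
  have "\<gamma> t \<bullet> (T - A) = 0" "\<gamma> t \<noteq> 0" using qA T' by (auto simp: inner_diff_right inner_commute)
  then obtain c where c: "T - A = c *\<^sub>R (\<i> * \<gamma> t)" using perp_imp_rotate by blast
  have "(T - A) \<bullet> u = c * ?k" unfolding c by (simp add: inner_complex_def cross_def algebra_simps)
  then have "c * ?k > 0" using Au exit_direction[OF ex T] by (simp add: inner_diff_left)
  then have c0: "c > 0" using k by (simp add: zero_less_mult_iff)
  have cr: "cross (T - A) (X - A) = c * (1 - X \<bullet> \<gamma> t)" for X
  proof -
    have "cross (T - A) (X - A) = c * (A \<bullet> \<gamma> t - X \<bullet> \<gamma> t)"
      unfolding c by (simp add: inner_complex_def cross_def algebra_simps)
    then show ?thesis using qA by simp
  qed
  have le: "X \<bullet> \<gamma> t \<le> 1" if "X \<in> dual_curve \<gamma>" for X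
    using that dual_tangent(5) curve_in_closure by (auto simp: dual_curve_def)
  have Tpt: "T \<in> dual_curve \<gamma>" "\<And>X. X \<in> dual_curve \<gamma> \<Longrightarrow> cross (T - A) (X - A) \<ge> 0"
    using T cr le c0 by (auto simp: dual_curve_def)
  have uniq: "T' = T" if "T' \<in> dual_curve \<gamma>" "\<And>X. X \<in> dual_curve \<gamma> \<Longrightarrow> cross (T' - A) (X - A) \<ge> 0"
    for T'
  proof -
    \<comment> \<open>Each of the two tangents has the other tangency point on its left, so they are collinear
      with \<open>A\<close>; hence \<open>T'\<close> touches the table at \<open>\<gamma> t\<close> too.\<close>
    have "cross (T' - A) (T - A) \<ge> 0" using that Tpt by blast
    moreover have "cross (T - A) (T' - A) = - cross (T' - A) (T - A)" by (simp add: cross_def)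
    ultimately have "cross (T - A) (T' - A) \<le> 0" by simp
    then have "T' \<bullet> \<gamma> t \<ge> 1" using cr c0 by (simp add: mult_le_0_iff)
    then have 1: "T' \<bullet> \<gamma> t = 1" using le that by force
    have "dual (tangent_line \<gamma> t) T'"
      by (rule touching_imp_dual_tangent[OF _ 1])
        (use that(1) dual_tangent(4) in \<open>auto simp: dual_curve_def intro: less_imp_le\<close>)
    then show ?thesis using T dual_unique by blast
  qed
  show ?thesis
    unfolding positive_tangent_def using Tpt uniq by metis
qed

text \<open>
  One collision in dual terms, with \<open>q\<close> the collision point and \<open>T\<close> the dual of its tangent. The
  outgoing direction \<open>w\<close> is a positive multiple of \<open>\<i> * A'\<close>, while the image of \<open>A\<close> under
  the angular map is the multiple of \<open>A'\<close> which has value \<open>1\<close> under \<open>q\<close>, if there is one.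
\<close>

lemma collision_duality:
  assumes a: "(S, u) \<in> billiard_lines \<gamma>" and A: "dual S A" and pos: "positive_line (S, u)"
  obtains q T A' k w where
    "q \<bullet> A = 1" "q \<bullet> T = 1" "T \<noteq> 0" "cross T A \<noteq> 0" "A' = reflect T A"
    "\<forall>l T'. positive_tangent (dual_curve \<gamma>) A l T' \<longrightarrow> T' = T"
    "A \<in> outside (dual_curve \<gamma>)"
    "A \<in> angular_singular (dual_curve \<gamma>) \<longleftrightarrow> q \<bullet> A' = 0"
    "q \<bullet> A' \<noteq> 0 \<longrightarrow> angular (dual_curve \<gamma>) A = A' /\<^sub>R (q \<bullet> A')"
    "birkhoff \<gamma> (S, u) = (line q w, w)" "norm w = 1" "w = k *\<^sub>R (\<i> * A')" "k > 0"
proof -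
  obtain t T where t: "exits_at \<gamma> (S, u) (\<gamma> t)" and T: "dual (tangent_line \<gamma> t) T"
    and B: "birkhoff \<gamma> (S, u) = (line (\<gamma> t) (reflect (velocity t) u), reflect (velocity t) u)"
    using birkhoff_collision[OF a] by (metis snd_conv)
  have ori: "is_oriented_line (S, u)" using a by (simp add: billiard_lines_def)
  note T' = dual_tangent[OF T]
  have qS: "\<gamma> t \<in> S" using t by (auto simp: exits_at_def)
  have qA: "\<gamma> t \<bullet> A = 1" using qS A by (auto simp: dual_iff inner_commute)
  have qT: "\<gamma> t \<bullet> T = 1" using T'(2) by (simp add: inner_commute)
  let ?k = "cross (\<gamma> t) u"
  have k: "?k > 0" using pos qS by (auto simp: positive_line_def)
  have u: "u = ?k *\<^sub>R (\<i> * A)" "A \<bullet> u = 0" using oriented_line_direction[OF ori A qS] by blast+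
  \<comment> \<open>The incoming line is not tangent: \<open>A\<close> annihilates its direction and \<open>T\<close> does not.\<close>
  have AT: "A \<noteq> T" using u(2) exit_direction[OF t T] by auto
  have crT: "cross T A \<noteq> 0"
  proof
    assume 0: "cross T A = 0"
    have "(\<i> * T) \<bullet> A = cross T A" by (simp add: inner_complex_def cross_def)
    then have "(T \<bullet> T) *\<^sub>R A = (T \<bullet> A) *\<^sub>R T" using rotate_expansion[of T A] 0 by simp
    then have "\<gamma> t \<bullet> ((T \<bullet> T) *\<^sub>R A) = \<gamma> t \<bullet> ((T \<bullet> A) *\<^sub>R T)" by simp
    then have "T \<bullet> T = T \<bullet> A" using qA qT by simp
    then have "A = T" using \<open>(T \<bullet> T) *\<^sub>R A = _\<close> T'(1) by (metis inner_eq_zero_iff scaleR_left_imp_eq)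
    then show False using AT by simp
  qed
  note ptan = positive_tangent_at_exit[OF ori A pos t T]
  have tp: "tangency_point (dual_curve \<gamma>) A = T"
    unfolding tangency_point_def ptan by auto
  have out: "A \<in> outside (dual_curve \<gamma>)"
    using outside_dual_curve_iff[OF A] a by (auto simp: billiard_lines_def)
  have w: "reflect (velocity t) u = ?k *\<^sub>R (\<i> * reflect T A)"
    using reflect_perp_rotate[OF T'(1) velocity_nonzero T'(3), of A] reflect_scaleR u(1) by metis
  have nw: "norm (reflect (velocity t) u) = 1"
    using norm_reflect[OF velocity_nonzero] ori by (simp add: is_oriented_line_def)
  have uniq: "\<forall>l T'. positive_tangent (dual_curve \<gamma>) A l T' \<longrightarrow> T' = T"
    using ptan by simp
  have ang: "\<gamma> t \<bullet> reflect T A \<noteq> 0 \<longrightarrow>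
      angular (dual_curve \<gamma>) A = reflect T A /\<^sub>R (\<gamma> t \<bullet> reflect T A)"
    using angular_eq[OF tp T'(1) AT qA qT] by blast
  have sing: "A \<in> angular_singular (dual_curve \<gamma>) \<longleftrightarrow> \<gamma> t \<bullet> reflect T A = 0"
    using angular_singular_iff[OF tp T'(1) AT qA qT] out by simp
  show ?thesis
    by (rule that[OF qA qT T'(1) crT refl uniq out sing ang B nw w k])
qed

text \<open>
  That the outgoing line has a dual point forces \<open>q \<bullet> A' \<noteq> 0\<close>, hence that \<open>A\<close> is not singular.
\<close>

lemma angular_dual_birkhoff:
  assumes l: "l \<in> billiard_lines \<gamma>" and "dual (fst l) A" "positive_line l"
    and B: "dual (fst (birkhoff \<gamma> l)) B"
  shows "A \<in> angular_domain (dual_curve \<gamma>) \<and> angular (dual_curve \<gamma>) A = B"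
proof -
  obtain S u where Su: "l = (S, u)" by (cases l)
  have Su': "(S, u) \<in> billiard_lines \<gamma>" "dual S A" "positive_line (S, u)"
    using assms by (simp_all add: Su)
  obtain q T0 A' k w where *: "q \<bullet> A = 1" "q \<bullet> T0 = 1" "T0 \<noteq> 0" "cross T0 A \<noteq> 0" "A' = reflect T0 A"
    "\<forall>l T'. positive_tangent (dual_curve \<gamma>) A l T' \<longrightarrow> T' = T0"
    "A \<in> outside (dual_curve \<gamma>)"
    "A \<in> angular_singular (dual_curve \<gamma>) \<longleftrightarrow> q \<bullet> A' = 0"
    "q \<bullet> A' \<noteq> 0 \<longrightarrow> angular (dual_curve \<gamma>) A = A' /\<^sub>R (q \<bullet> A')"
    "birkhoff \<gamma> (S, u) = (line q w, w)" "norm w = 1" "w = k *\<^sub>R (\<i> * A')" "k > 0"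
    by (rule collision_duality[OF Su']) (rule that; assumption)
  have lB: "line q w = {X. B \<bullet> X = 1}" and B0: "B \<noteq> 0" using B *(10) by (auto simp: Su dual_iff)
  have "q \<in> line q w" "q + w \<in> line q w"
    unfolding line_def by (auto intro: range_eqI[of _ _ 0] range_eqI[of _ _ 1])
  then have Bq: "B \<bullet> q = 1" and Bw: "B \<bullet> w = 0" unfolding lB by (auto simp: inner_add_right)
  have A'0: "A' \<noteq> 0" using *(11,12) by auto
  have "A' \<bullet> (\<i> * B) = 0"
    using Bw *(12,13) by (simp add: inner_complex_def algebra_simps)
  then obtain c where "\<i> * B = c *\<^sub>R (\<i> * A')" using perp_imp_rotate A'0 by blast
  then have "\<i> * B = \<i> * (c *\<^sub>R A')" by simp
  then have Bc: "B = c *\<^sub>R A'" by (simp only: mult_cancel_left) simp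
  then have "c * (q \<bullet> A') = 1" using Bq by (simp add: inner_commute)
  then show ?thesis using *(7,8,9) Bc by (auto simp: angular_domain_def field_simps)
qed

text \<open>
  The billiard image of \<open>a\<close> and the line \<open>b\<close> have the same dual point, so they agree up to
  orientation; \<open>b\<close> is positive, and the image is positive iff \<open>q \<bullet> A' > 0\<close>.
\<close>

lemma birkhoff_of_angular:
  assumes dom: "A \<in> angular_domain (dual_curve \<gamma>)" and Beq: "B = angular (dual_curve \<gamma>) A"
    and a: "is_oriented_line a" "positive_line a" "dual (fst a) A"
    and b: "is_oriented_line b" "positive_line b" "dual (fst b) B"
    and tan: "positive_tangent (dual_curve \<gamma>) A l T"
  shows "a \<in> billiard_lines \<gamma>"
    and "birkhoff \<gamma> a = (if T \<in> closed_segment A B then b else reverse b)"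
proof -
  have out: "A \<in> outside (dual_curve \<gamma>)" "A \<notin> angular_singular (dual_curve \<gamma>)"
    using dom by (auto simp: angular_domain_def)
  show abl: "a \<in> billiard_lines \<gamma>"
    using outside_dual_curve_iff[OF a(3)] out(1) a(1) by (simp add: billiard_lines_def)
  obtain S u where Su: "a = (S, u)" by (cases a)
  have Su': "(S, u) \<in> billiard_lines \<gamma>" "dual S A" "positive_line (S, u)"
    using abl a by (simp_all add: Su)
  obtain q T0 A' k w where *: "q \<bullet> A = 1" "q \<bullet> T0 = 1" "T0 \<noteq> 0" "cross T0 A \<noteq> 0" "A' = reflect T0 A"
    "\<forall>l T'. positive_tangent (dual_curve \<gamma>) A l T' \<longrightarrow> T' = T0"
    "A \<in> outside (dual_curve \<gamma>)"
    "A \<in> angular_singular (dual_curve \<gamma>) \<longleftrightarrow> q \<bullet> A' = 0"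
    "q \<bullet> A' \<noteq> 0 \<longrightarrow> angular (dual_curve \<gamma>) A = A' /\<^sub>R (q \<bullet> A')"
    "birkhoff \<gamma> (S, u) = (line q w, w)" "norm w = 1" "w = k *\<^sub>R (\<i> * A')" "k > 0"
    by (rule collision_duality[OF Su']) (rule that; assumption)
  have TT: "T = T0" using *(6) tan by blast
  define m where "m = q \<bullet> A'"
  have m: "m \<noteq> 0" using out *(8) by (simp add: m_def)
  have B: "B = A' /\<^sub>R m" using *(9) m Beq by (simp add: m_def)
  have seg: "T \<in> closed_segment A B \<longleftrightarrow> m > 0"
    using tangency_point_in_segment_iff[OF *(3,4,1,2) _ m] *(5) unfolding m_def TT B by blast
  obtain Sb ub where Sb: "b = (Sb, ub)" by (cases b)
  have lB: "Sb = {X. B \<bullet> X = 1}" and B0: "B \<noteq> 0" using b(3) by (auto simp: dual_iff Sb)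
  have Bq: "B \<bullet> q = 1" using m by (simp add: B m_def inner_commute)
  have Bw: "B \<bullet> w = 0" by (simp add: B *(12) inner_complex_def)
  have line: "Sb = line q w"
    using line_eq_level_set[OF B0 _ Bq Bw] *(11) lB by fastforce
  have qSb: "q \<in> Sb" using Bq lB by simp
  let ?c = "cross q ub"
  have ub: "ub = ?c *\<^sub>R (\<i> * B)"
    using oriented_line_direction[of Sb ub B q] b qSb by (simp add: Sb)
  have c: "?c > 0" using b(2) qSb by (auto simp: positive_line_def Sb)
  have nub: "norm ub = 1" using b(1) by (simp add: is_oriented_line_def Sb)
  have w: "w = (k * m) *\<^sub>R (\<i> * B)" using *(12) m by (simp add: B)
  \<comment> \<open>Both directions are unit multiples of \<open>\<i> * B\<close>, so only the sign of the factor matters.\<close>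
  have "?c * norm B = 1" using arg_cong[OF ub, of norm] nub c by (simp add: norm_mult)
  moreover have "\<bar>k * m\<bar> * norm B = 1" using arg_cong[OF w, of norm] *(11) by (simp add: norm_mult)
  ultimately have "?c = \<bar>k * m\<bar>" using B0 by (metis mult_right_cancel norm_eq_zero)
  then have "?c = (if m > 0 then k * m else - (k * m))"
    using *(13) m by (simp add: abs_mult)
  then have "w = (if m > 0 then ub else - ub)" using ub w
    by (metis (no_types, opaque_lifting) minus_minus scaleR_minus_left)
  then show "birkhoff \<gamma> a = (if T \<in> closed_segment A B then b else reverse b)"
    using *(10) line by (simp add: Su seg Sb reverse_def)
qed

end

theorem theorem2:
  fixes \<gamma> :: "real \<Rightarrow> complex" and \<Gamma> :: "complex set"
  assumes "smooth_convex_closed_curve \<gamma>"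
    and "0 \<in> inside (path_image \<gamma>)"
    and "\<Gamma> = dual_curve \<gamma>"
  shows
    "(\<forall>l\<^sub>0 \<in> billiard_lines \<gamma>. \<forall>l\<^sub>1 l\<^sub>m L\<^sub>0 L\<^sub>1 L\<^sub>m.
        l\<^sub>1 = birkhoff \<gamma> l\<^sub>0 \<and> l\<^sub>m = inv_into (billiard_lines \<gamma>) (birkhoff \<gamma>) l\<^sub>0 \<and>
        dual (fst l\<^sub>0) L\<^sub>0 \<longrightarrow>
          (positive_line l\<^sub>0 \<and> dual (fst l\<^sub>1) L\<^sub>1 \<longrightarrow>
             L\<^sub>0 \<in> angular_domain \<Gamma> \<and> angular \<Gamma> L\<^sub>0 = L\<^sub>1) \<and>
          (negative_line l\<^sub>0 \<and> dual (fst l\<^sub>m) L\<^sub>m \<longrightarrow>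
             L\<^sub>0 \<in> angular_domain \<Gamma> \<and> angular \<Gamma> L\<^sub>0 = L\<^sub>m))
     \<and>
     (\<forall>A \<in> angular_domain \<Gamma>. \<forall>B a b l T.
        B = angular \<Gamma> A \<and>
        is_oriented_line a \<and> positive_line a \<and> dual (fst a) A \<and>
        is_oriented_line b \<and> positive_line b \<and> dual (fst b) B \<and>
        positive_tangent \<Gamma> A l T \<longrightarrow>
          a \<in> billiard_lines \<gamma> \<and>
          (T \<in> closed_segment A B \<longrightarrow> birkhoff \<gamma> a = b) \<and>
          (T \<notin> closed_segment A B \<longrightarrow> birkhoff \<gamma> a = reverse b))"
proof -
  interpret billiard_table \<gamma> using assms by unfold_locales
  have pos: "L\<^sub>0 \<in> angular_domain \<Gamma> \<and> angular \<Gamma> L\<^sub>0 = L\<^sub>1"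
    if "l\<^sub>0 \<in> billiard_lines \<gamma>" "dual (fst l\<^sub>0) L\<^sub>0" "positive_line l\<^sub>0"
      "dual (fst (birkhoff \<gamma> l\<^sub>0)) L\<^sub>1" for l\<^sub>0 L\<^sub>0 L\<^sub>1
    using angular_dual_birkhoff[OF that] assms(3) by simp
  have neg: "L\<^sub>0 \<in> angular_domain \<Gamma> \<and> angular \<Gamma> L\<^sub>0 = L\<^sub>m"
    if "l\<^sub>0 \<in> billiard_lines \<gamma>" "dual (fst l\<^sub>0) L\<^sub>0" "negative_line l\<^sub>0"
      "dual (fst (inv_into (billiard_lines \<gamma>) (birkhoff \<gamma>) l\<^sub>0)) L\<^sub>m" for l\<^sub>0 L\<^sub>0 L\<^sub>m
    using angular_dual_birkhoff[of "reverse l\<^sub>0" L\<^sub>0 L\<^sub>m] that inv_birkhoff[OF that(1)] assms(3)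
    by (simp add: positive_reverse reverse_in_billiard_lines)
  have ang: "a \<in> billiard_lines \<gamma> \<and>
      (T \<in> closed_segment A B \<longrightarrow> birkhoff \<gamma> a = b) \<and>
      (T \<notin> closed_segment A B \<longrightarrow> birkhoff \<gamma> a = reverse b)"
    if "A \<in> angular_domain \<Gamma>" "B = angular \<Gamma> A"
      "is_oriented_line a" "positive_line a" "dual (fst a) A"
      "is_oriented_line b" "positive_line b" "dual (fst b) B"
      "positive_tangent \<Gamma> A l T" for A B a b l T
    using birkhoff_of_angular[OF that[unfolded assms(3)]] by simp
  show ?thesis
  proof (rule conjI; intro ballI allI impI; elim conjE)
    fix l\<^sub>0 l\<^sub>1 l\<^sub>m L\<^sub>0 L\<^sub>1 L\<^sub>m
    assume l: "l\<^sub>0 \<in> billiard_lines \<gamma>" "dual (fst l\<^sub>0) L\<^sub>0"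
      and eqs: "l\<^sub>1 = birkhoff \<gamma> l\<^sub>0" "l\<^sub>m = inv_into (billiard_lines \<gamma>) (birkhoff \<gamma>) l\<^sub>0"
    show "(positive_line l\<^sub>0 \<and> dual (fst l\<^sub>1) L\<^sub>1 \<longrightarrow>
             L\<^sub>0 \<in> angular_domain \<Gamma> \<and> angular \<Gamma> L\<^sub>0 = L\<^sub>1) \<and>
          (negative_line l\<^sub>0 \<and> dual (fst l\<^sub>m) L\<^sub>m \<longrightarrow>
             L\<^sub>0 \<in> angular_domain \<Gamma> \<and> angular \<Gamma> L\<^sub>0 = L\<^sub>m)"
      unfolding eqs using pos[OF l] neg[OF l] by blast
  qed (rule ang)
qed

end
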